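(* Let $G$ be a semisimple linear Lie group with Lie algebra $\mathfrak{g}$, and let $u\in G$ be a unipotent element, written as $u=\exp X$ with $X\in\mathfrak{g}$ nilpotent. Then $u$ is real (respectively, strongly real) in $G$ if and only if $X$ is $\mathrm{Ad}_G$-real (respectively, strongly $\mathrm{Ad}_G$-real) in $\mathfrak{g}$.
   Context: An element $g$ of a group $G$ is real if $g^{-1}=hgh^{-1}$ for some $h\in G$; it is strongly real if there is $h\in G$ with $h^2=\mathrm{Id}$ and $g^{-1}=hgh^{-1}$ (equivalently, $g$ is a product of two involutions, the identity being allowed as an involution). For a Lie group $G$ with Lie algebra $\mathfrak{g}$ and $\mathrm{Ad}\colon G\to \mathrm{GL}(\mathfrak{g})$ the adjoint representation, $X\in\mathfrak{g}$ is $\mathrm{Ad}_G$-real if $-X=\mathrm{Ad}(g)X$ for some $g\in G$, and strongly $\mathrm{Ad}_G$-real if $-X=\mathrm{Ad}(\tau)X$ for some $\tau\in G$ with $\tau^2=\mathrm{Id}$. The exponential map gives a $G$-equivariant bijection between the nilpotent elements of $\mathfrak{g}$ and the unipotent elements of $G$. *)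

theory Defs
  imports "HOL-Analysis.Analysis" "HOL-Algebra.Coset"
begin

section \<open>Real and strongly real elements of a group\<close>

definition real_element :: "('a, 'b) monoid_scheme \<Rightarrow> 'a \<Rightarrow> bool" where
  "real_element G g \<longleftrightarrow> g \<in> carrier G \<and>
     (\<exists>h \<in> carrier G. inv\<^bsub>G\<^esub> g = h \<otimes>\<^bsub>G\<^esub> g \<otimes>\<^bsub>G\<^esub> inv\<^bsub>G\<^esub> h)"

definition strongly_real_element :: "('a, 'b) monoid_scheme \<Rightarrow> 'a \<Rightarrow> bool" where
  "strongly_real_element G g \<longleftrightarrow> g \<in> carrier G \<and>
     (\<exists>h \<in> carrier G. h \<otimes>\<^bsub>G\<^esub> h = \<one>\<^bsub>G\<^esub> \<and>
        inv\<^bsub>G\<^esub> g = h \<otimes>\<^bsub>G\<^esub> g \<otimes>\<^bsub>G\<^esub> inv\<^bsub>G\<^esub> h)"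


section \<open>Matrices\<close>

text \<open>The type class operations \<open>*\<close>, \<open>1\<close> and \<open>^\<close> on vectors are componentwise,
  so matrix powers and the matrix exponential are defined from \<open>**\<close> and \<open>mat 1\<close>.\<close>

definition mat_pow :: "complex^'n^'n \<Rightarrow> nat \<Rightarrow> complex^'n^'n" where
  "mat_pow A k = ((\<lambda>B. A ** B) ^^ k) (mat 1)"

definition mat_exp :: "complex^'n^'n \<Rightarrow> complex^'n^'n" where
  "mat_exp A = (\<Sum>k. (1 / fact k) *\<^sub>R mat_pow A k)"

definition nilpotent_matrix :: "complex^'n^'n \<Rightarrow> bool" where
  "nilpotent_matrix A \<longleftrightarrow> (\<exists>k. mat_pow A k = 0)"

definition unipotent_matrix :: "complex^'n^'n \<Rightarrow> bool" where
  "unipotent_matrix A \<longleftrightarrow> nilpotent_matrix (A - mat 1)"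

definition GL :: "(complex^'n^'n) monoid" where
  "GL = \<lparr>carrier = {A. invertible A}, mult = (**), one = mat 1\<rparr>"

lemma group_GL: "group (GL :: (complex^'n^'n) monoid)"
proof (rule groupI)
  fix A :: "complex^'n^'n"
  assume "A \<in> carrier GL"
  then show "\<exists>B\<in>carrier GL. B \<otimes>\<^bsub>GL\<^esub> A = \<one>\<^bsub>GL\<^esub>"
    by (auto simp: GL_def invertible_def)
qed (auto simp: GL_def invertible_mult matrix_mul_assoc invertible_def[of "mat 1"])


section \<open>Semisimple matrix Lie algebras\<close>

text \<open>Lie algebras here are real: \<open>subspace\<close> and \<open>span\<close> refer to the real vector space
  structure of the complex matrices.\<close>

definition bracket :: "complex^'n^'n \<Rightarrow> complex^'n^'n \<Rightarrow> complex^'n^'n" where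
  "bracket A B = A ** B - B ** A"

definition lie_ideal :: "(complex^'n^'n) set \<Rightarrow> (complex^'n^'n) set \<Rightarrow> bool" where
  "lie_ideal I \<gg> \<longleftrightarrow> subspace I \<and> I \<subseteq> \<gg> \<and> (\<forall>X\<in>\<gg>. \<forall>Y\<in>I. bracket X Y \<in> I)"

definition derived_algebra :: "(complex^'n^'n) set \<Rightarrow> (complex^'n^'n) set" where
  "derived_algebra I = span {bracket X Y | X Y. X \<in> I \<and> Y \<in> I}"

definition solvable_algebra :: "(complex^'n^'n) set \<Rightarrow> bool" where
  "solvable_algebra I \<longleftrightarrow> (\<exists>k. (derived_algebra ^^ k) I = {0})"

text \<open>Semisimplicity: the solvable radical vanishes.\<close>

definition semisimple_algebra :: "(complex^'n^'n) set \<Rightarrow> bool" where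
  "semisimple_algebra \<gg> \<longleftrightarrow> (\<forall>I. lie_ideal I \<gg> \<and> solvable_algebra I \<longrightarrow> I = {0})"


section \<open>Linear Lie groups and their adjoint representation\<close>

text \<open>A linear Lie group is a subgroup of the general linear group that is closed in the
  relative topology of the latter. Complex matrices also cover the closed subgroups of the
  real general linear group, which is itself closed in the complex one.\<close>

definition linear_lie_group :: "(complex^'n^'n) set \<Rightarrow> bool" where
  "linear_lie_group G \<longleftrightarrow> subgroup G GL \<and> closedin (top_of_set (carrier GL)) G"

text \<open>The parameter \<open>t\<close> is real, so this is the Lie algebra of \<open>G\<close> as a real Lie group.\<close>

definition lie_algebra :: "(complex^'n^'n) set \<Rightarrow> (complex^'n^'n) set" where
  "lie_algebra G = {X. \<forall>t::real. mat_exp (t *\<^sub>R X) \<in> G}"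

definition semisimple_linear_lie_group :: "(complex^'n^'n) set \<Rightarrow> bool" where
  "semisimple_linear_lie_group G \<longleftrightarrow> linear_lie_group G \<and> semisimple_algebra (lie_algebra G)"

definition Ad :: "complex^'n^'n \<Rightarrow> complex^'n^'n \<Rightarrow> complex^'n^'n" where
  "Ad g X = g ** X ** matrix_inv g"

definition Ad_real :: "(complex^'n^'n) set \<Rightarrow> complex^'n^'n \<Rightarrow> bool" where
  "Ad_real G X \<longleftrightarrow> X \<in> lie_algebra G \<and> (\<exists>g\<in>G. - X = Ad g X)"

definition strongly_Ad_real :: "(complex^'n^'n) set \<Rightarrow> complex^'n^'n \<Rightarrow> bool" where
  "strongly_Ad_real G X \<longleftrightarrow>
     X \<in> lie_algebra G \<and> (\<exists>\<tau>\<in>G. \<tau> ** \<tau> = mat 1 \<and> - X = Ad \<tau> X)"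

end

theory Submission imports Defs begin

text \<open>The exponential intertwines conjugation and turns negation into inversion, so everything
  reduces to its injectivity on nilpotent matrices. If \<open>exp A = exp B\<close>, then
  \<open>exp (n A) = exp (n B)\<close> for every natural \<open>n\<close>. For nilpotent \<open>A\<close> and \<open>B\<close> both sides
  are polynomial in \<open>n\<close>, so their linear coefficients \<open>A\<close> and \<open>B\<close> agree.\<close>

text \<open>Gives access to the library rules for bilinear maps over the reals: zeros, real scalars
  and finite double sums all pass through \<open>**\<close>.\<close>

lemma bilinear_matrix_mult:
  "bilinear ((**) :: complex^'n^'m \<Rightarrow> complex^'p^'n \<Rightarrow> complex^'p^'m)"
  unfolding bilinear_def
  by (auto intro!: linearI simp: matrix_add_ldistrib matrix_matrix_mult_def vec_eq_iff
        sum.distrib distrib_left distrib_right scaleR_sum_right)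

lemma
  assumes "invertible A"
  shows matrix_inv_right: "A ** matrix_inv A = mat 1"
    and matrix_inv_left: "matrix_inv A ** A = mat 1"
  using assms unfolding invertible_def matrix_inv_def by (metis (mono_tags, lifting) someI_ex)+

lemma mat_pow_0 [simp]: "mat_pow A 0 = mat 1"
  by (simp add: mat_pow_def)

lemma mat_pow_Suc [simp]: "mat_pow A (Suc k) = A ** mat_pow A k"
  by (simp add: mat_pow_def)

lemma mat_pow_add: "mat_pow A (i + j) = mat_pow A i ** mat_pow A j"
  by (induction i) (simp_all add: matrix_mul_assoc)

lemma mat_pow_eq_0_mono:
  assumes "mat_pow A k = 0" "k \<le> m"
  shows "mat_pow A m = 0"
  using mat_pow_add[of A k "m - k"] assms by (simp add: bilinear_lzero[OF bilinear_matrix_mult])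

lemma mat_pow_scaleR: "mat_pow (t *\<^sub>R A) k = t ^ k *\<^sub>R mat_pow A k"
  by (induction k) (simp_all add: bilinear_lmul[OF bilinear_matrix_mult]
      bilinear_rmul[OF bilinear_matrix_mult] mult.commute)

text \<open>Any vanishing power serves as cutoff, not just the least one, so two nilpotent matrices
  can share one \<open>N\<close>.\<close>

lemma mat_exp_nilpotent:
  assumes "mat_pow A N = 0"
  shows "mat_exp A = (\<Sum>k<N. (1 / fact k) *\<^sub>R mat_pow A k)"
  unfolding mat_exp_def
  by (rule suminf_finite) (use assms mat_pow_eq_0_mono in \<open>auto simp: not_less\<close>)

lemma mat_exp_scaleR_nilpotent:
  assumes "mat_pow A N = 0"
  shows "mat_exp (t *\<^sub>R A) = (\<Sum>k<N. (t ^ k /\<^sub>R fact k) *\<^sub>R mat_pow A k)"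
  using mat_exp_nilpotent[of "t *\<^sub>R A" N] assms
  by (simp add: mat_pow_scaleR field_simps)

lemma mat_exp_add_scaleR_nilpotent:
  assumes "nilpotent_matrix A"
  shows "mat_exp ((s + t) *\<^sub>R A) = mat_exp (s *\<^sub>R A) ** mat_exp (t *\<^sub>R A)"
proof -
  obtain N where N: "mat_pow A N = 0"
    using assms by (auto simp: nilpotent_matrix_def)
  define f where "f = (\<lambda>i j. ((s ^ i /\<^sub>R fact i) * (t ^ j /\<^sub>R fact j)) *\<^sub>R mat_pow A (i + j))"
  have "mat_exp (s *\<^sub>R A) ** mat_exp (t *\<^sub>R A) = (\<Sum>(i, j)\<in>{..<N} \<times> {..<N}. f i j)"
    unfolding mat_exp_scaleR_nilpotent[OF N] bilinear_sum[OF bilinear_matrix_mult]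
    by (simp add: f_def mat_pow_add bilinear_lmul[OF bilinear_matrix_mult]
        bilinear_rmul[OF bilinear_matrix_mult] ac_simps)
  \<comment> \<open>The square of index pairs shrinks to a triangle because \<open>f i j\<close>
    contains \<open>mat_pow A (i + j)\<close>, which is zero once \<open>i + j\<close> reaches
    \<open>N\<close>.\<close>
  also have "\<dots> = (\<Sum>(i, j)\<in>{(i, j). i + j < N}. f i j)"
    by (rule sum.mono_neutral_right)
      (auto simp: f_def not_less intro!: mat_pow_eq_0_mono[OF N])
  also have "\<dots> = (\<Sum>k<N. \<Sum>i\<le>k. f i (k - i))"
    by (rule sum.triangle_reindex)
  \<comment> \<open>On each diagonal the matrix factor is constant, and the scalars add up by the
    binomial theorem.\<close>
  also have "\<dots> = (\<Sum>k<N. ((s + t) ^ k /\<^sub>R fact k) *\<^sub>R mat_pow A k)"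
    by (rule sum.cong[OF refl], subst exp_series_add_commuting)
      (simp_all add: f_def scaleR_sum_left)
  finally show ?thesis
    by (simp add: mat_exp_scaleR_nilpotent[OF N])
qed

lemma mat_exp_0 [simp]: "mat_exp 0 = mat 1"
  using mat_exp_nilpotent[of "0 :: complex^'n^'n" 1]
  by (simp add: bilinear_lzero[OF bilinear_matrix_mult])

lemma mat_exp_uminus_nilpotent:
  assumes "nilpotent_matrix A"
  shows "mat_exp (- A) ** mat_exp A = mat 1"
  using mat_exp_add_scaleR_nilpotent[OF assms, of "-1" 1] by simp

text \<open>Shows that the exponential of \<open>A\<close> determines those of all natural multiples
  of \<open>A\<close>.\<close>

lemma mat_exp_of_nat_nilpotent:
  assumes "nilpotent_matrix A"
  shows "mat_exp (real n *\<^sub>R A) = mat_pow (mat_exp A) n"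
proof (induction n)
  case (Suc n)
  then show ?case
    using mat_exp_add_scaleR_nilpotent[OF assms, of 1 "real n"] by simp
qed simp

lemma mat_exp_inj_nilpotent:
  assumes "nilpotent_matrix A" "nilpotent_matrix B" "mat_exp A = mat_exp B"
  shows "A = B"
proof -
  obtain k l where kl: "mat_pow A k = 0" "mat_pow B l = 0"
    using assms by (auto simp: nilpotent_matrix_def)
  \<comment> \<open>Large enough to annihilate both matrices, and at least 1 so that degree 1 occurs
    in the polynomial below.\<close>
  define N where "N = Suc (k + l)"
  have A: "mat_pow A (Suc N) = 0" and B: "mat_pow B (Suc N) = 0"
    using kl by (auto intro: mat_pow_eq_0_mono simp: N_def simp del: mat_pow_Suc)
  have "(A - B) $ a $ b = 0" for a b
  proof (rule ccontr)
    \<comment> \<open>The coefficients of the entry at \<open>a\<close>, \<open>b\<close> of the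
      difference of the two exponentials, as a polynomial in the scalar; \<open>c 1\<close> is the
      entry of \<open>A - B\<close>. A nonzero \<open>c 1\<close> allows only finitely many roots,
      yet every natural number is one.\<close>
    define c where "c = (\<lambda>k. ((1 / fact k) *\<^sub>R (mat_pow A k - mat_pow B k)) $ a $ b)"
    assume "(A - B) $ a $ b \<noteq> 0"
    then have "c 1 \<noteq> 0" "1 \<le> N"
      by (simp_all add: c_def N_def)
    then have fin: "finite {z. (\<Sum>i\<le>N. c i * z ^ i) = 0}"
      by (metis polyfun_rootbound)
    have "(\<Sum>i\<le>N. c i * of_nat n ^ i) = 0" for n
    proof -
      have "0 = (mat_exp (real n *\<^sub>R A) - mat_exp (real n *\<^sub>R B)) $ a $ b"
        using assms by (simp add: mat_exp_of_nat_nilpotent)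
      also have "\<dots> = (\<Sum>i\<le>N. c i * of_nat n ^ i)"
        unfolding mat_exp_scaleR_nilpotent[OF A] mat_exp_scaleR_nilpotent[OF B]
          sum_subtractf[symmetric] lessThan_Suc_atMost sum_component
        by (rule sum.cong) (simp_all add: c_def scaleR_conv_of_real[where 'a = complex] field_simps)
      finally show ?thesis by simp
    qed
    then have "range (of_nat :: nat \<Rightarrow> complex) \<subseteq> {z. (\<Sum>i\<le>N. c i * z ^ i) = 0}"
      by auto
    then show False
      using fin finite_subset range_inj_infinite[OF inj_of_nat] by blast
  qed
  then show ?thesis
    by (simp add: vec_eq_iff)
qed

lemma mat_pow_Ad:
  assumes "invertible g"
  shows "mat_pow (Ad g A) k = Ad g (mat_pow A k)"
proof (induction k)
  case 0
  then show ?case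
    using assms by (simp add: Ad_def matrix_inv_right)
next
  case (Suc k)
  \<comment> \<open>The inner factors \<open>matrix_inv g ** g\<close> cancel.\<close>
  have "Ad g A ** Ad g C = Ad g (A ** C)" for C
    unfolding Ad_def using assms
    by (metis matrix_inv_left matrix_mul_assoc matrix_mul_rid)
  with Suc show ?case
    by simp
qed

lemma linear_Ad: "linear (Ad g)"
  unfolding Ad_def
  by (rule linearI) (simp_all add: bilinear_ladd[OF bilinear_matrix_mult]
      bilinear_radd[OF bilinear_matrix_mult] bilinear_lmul[OF bilinear_matrix_mult]
      bilinear_rmul[OF bilinear_matrix_mult])

lemma nilpotent_Ad:
  assumes "invertible g" "nilpotent_matrix A"
  shows "nilpotent_matrix (Ad g A)"
  using assms by (metis nilpotent_matrix_def mat_pow_Ad linear_0[OF linear_Ad])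

lemma mat_exp_Ad_nilpotent:
  assumes "invertible g" "nilpotent_matrix A"
  shows "mat_exp (Ad g A) = Ad g (mat_exp A)"
proof -
  obtain N where N: "mat_pow A N = 0"
    using assms by (auto simp: nilpotent_matrix_def)
  then have AdN: "mat_pow (Ad g A) N = 0"
    by (simp add: mat_pow_Ad[OF assms(1)] linear_0[OF linear_Ad])
  show ?thesis
    by (simp add: mat_exp_nilpotent[OF N] mat_exp_nilpotent[OF AdN] mat_pow_Ad[OF assms(1)] linear_sum[OF linear_Ad]
        linear_cmul[OF linear_Ad])
qed

lemma nilpotent_uminus:
  assumes "nilpotent_matrix A"
  shows "nilpotent_matrix (- A)"
  using assms mat_pow_scaleR[of "-1" A] by (auto simp: nilpotent_matrix_def)

text \<open>\<open>Ad g\<close> moves inside the exponential, and both \<open>- A\<close> and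
  \<open>Ad g A\<close> are nilpotent, so injectivity applies.\<close>

lemma mat_exp_uminus_eq_Ad_iff:
  assumes "invertible g" "nilpotent_matrix A"
  shows "mat_exp (- A) = Ad g (mat_exp A) \<longleftrightarrow> - A = Ad g A"
  using assms
  by (metis mat_exp_Ad_nilpotent mat_exp_inj_nilpotent nilpotent_Ad nilpotent_uminus)

text \<open>Inverses in a subgroup agree with those of \<open>GL\<close>, where a left inverse is
  unique.\<close>

lemma inv_GL_subgroup:
  assumes "subgroup G GL" "h \<in> G"
  shows "inv\<^bsub>GL\<lparr>carrier := G\<rparr>\<^esub> h = matrix_inv h"
proof -
  have h: "h \<in> carrier GL"
    using assms subgroup.subset by blast
  then have "invertible h"
    by (simp add: GL_def)
  then have "matrix_inv h ** h = mat 1" "h ** matrix_inv h = mat 1"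
    by (simp_all add: matrix_inv_left matrix_inv_right)
  then have "inv\<^bsub>GL\<^esub> h = matrix_inv h"
    using h by (intro group.inv_equality[OF group_GL]) (auto simp: GL_def invertible_def)
  then show ?thesis
    using group.m_inv_consistent[OF group_GL assms] by simp
qed

theorem corollary2p2:
  fixes G :: "(complex^'n^'n) set" and u X :: "complex^'n^'n"
  assumes "semisimple_linear_lie_group G"
    and "u \<in> G" and "unipotent_matrix u"
    and "X \<in> lie_algebra G" and "nilpotent_matrix X"
    and "u = mat_exp X"
  shows "(real_element (GL\<lparr>carrier := G\<rparr>) u \<longleftrightarrow> Ad_real G X) \<and>
         (strongly_real_element (GL\<lparr>carrier := G\<rparr>) u \<longleftrightarrow> strongly_Ad_real G X)"
proof -
  have G: "subgroup G GL"
    using assms(1) by (simp add: semisimple_linear_lie_group_def linear_lie_group_def)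
  have invertible: "invertible h" if "h \<in> G" for h
    using subgroup.subset[OF G] that by (auto simp: GL_def)
  have "matrix_inv u = mat_exp (- X)"
    using mat_exp_uminus_nilpotent[OF assms(5)] matrix_inv_right[OF invertible[OF assms(2)]]
    unfolding assms(6) by (metis matrix_mul_assoc matrix_mul_lid matrix_mul_rid)
  \<comment> \<open>The same \<open>h\<close> works on both sides, so a condition such as being an
    involution carries over and both equivalences follow together.\<close>
  then have "inv\<^bsub>GL\<lparr>carrier := G\<rparr>\<^esub> u =
      h \<otimes>\<^bsub>GL\<lparr>carrier := G\<rparr>\<^esub> u \<otimes>\<^bsub>GL\<lparr>carrier := G\<rparr>\<^esub> inv\<^bsub>GL\<lparr>carrier := G\<rparr>\<^esub> h
        \<longleftrightarrow> - X = Ad h X" if "h \<in> G" for h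
    using mat_exp_uminus_eq_Ad_iff[OF invertible[OF that] assms(5)] assms(2,6) that
    by (simp add: inv_GL_subgroup[OF G]) (simp add: GL_def Ad_def)
  then show ?thesis
    using assms(2,4)
    by (auto simp: real_element_def strongly_real_element_def Ad_real_def strongly_Ad_real_def
        GL_def)
qed

end
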